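(* If $G$ is a finite non-abelian induced regular group, then $G/Z(G)$ is a $p$-group for some prime $p$.
   Context: For a finite group $G$, $C_G(x)$ denotes the centralizer of $x\in G$ and $Z(G)$ the center. The non-centralizer graph $\Upsilon_G$ is the simple graph with vertex set $G$ in which two distinct vertices $x,y$ are adjacent iff $C_G(x)\neq C_G(y)$; the induced non-centralizer graph $\Upsilon_{G\setminus Z(G)}$ is its induced subgraph on $G\setminus Z(G)$. $G$ is called induced regular if $\Upsilon_{G\setminus Z(G)}$ is a regular graph (all vertices have the same degree). *)

theory Defs
  imports "HOL-Algebra.Algebra"
begin

definition centralizer :: "('a, 'b) monoid_scheme \<Rightarrow> 'a \<Rightarrow> 'a set" where
  "centralizer G x = {y \<in> carrier G. x \<otimes>\<^bsub>G\<^esub> y = y \<otimes>\<^bsub>G\<^esub> x}"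

definition group_center :: "('a, 'b) monoid_scheme \<Rightarrow> 'a set" where
  "group_center G = {z \<in> carrier G. \<forall>y \<in> carrier G. z \<otimes>\<^bsub>G\<^esub> y = y \<otimes>\<^bsub>G\<^esub> z}"

definition noncentralizer_adj :: "('a, 'b) monoid_scheme \<Rightarrow> 'a \<Rightarrow> 'a \<Rightarrow> bool" where
  "noncentralizer_adj G x y \<longleftrightarrow> x \<noteq> y \<and> centralizer G x \<noteq> centralizer G y"

definition induced_nc_degree :: "('a, 'b) monoid_scheme \<Rightarrow> 'a \<Rightarrow> nat" where
  "induced_nc_degree G x =
     card {y \<in> carrier G - group_center G. noncentralizer_adj G x y}"

definition induced_regular :: "('a, 'b) monoid_scheme \<Rightarrow> bool" where
  "induced_regular G \<longleftrightarrow>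
     (\<forall>x \<in> carrier G - group_center G. \<forall>y \<in> carrier G - group_center G.
        induced_nc_degree G x = induced_nc_degree G y)"

definition is_p_group :: "('a, 'b) monoid_scheme \<Rightarrow> nat \<Rightarrow> bool" where
  "is_p_group H p \<longleftrightarrow> Factorial_Ring.prime p \<and> finite (carrier H) \<and> (\<exists>n. order H = p ^ n)"

end

theory Submission
  imports Defs
begin

text \<open>
  Elements with the same centralizer form a class, and regularity means that all classes of
  noncentral elements have the same size \<open>c\<close>. Let \<open>Z\<close> be the center of \<open>G\<close>. The center \<open>D x\<close> of
  the centralizer \<open>C x\<close> is the union of \<open>Z\<close> and the classes of the \<open>y\<close> with \<open>C x \<subseteq> C y\<close>; for
  noncentral \<open>x\<close> it has order \<open>N = |Z| + c\<close> if and only if \<open>C x\<close> is maximal.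

  Let \<open>|G| = a b\<close> with coprime \<open>a\<close> and \<open>b\<close>, and suppose that there are noncentral elements
  of order dividing \<open>a\<close> and noncentral elements of order dividing \<open>b\<close>. If \<open>u\<close> is of the first
  kind, \<open>v\<close> of the second kind, and \<open>u\<close> and \<open>v\<close> commute, then \<open>C (u v) = C u \<inter> C v\<close>. Counting the
  products \<open>u v\<close> that fall into a single class shows that every \<open>D x\<close> contains elements of both
  kinds and that all noncentral centralizers are maximal; hence they are commutative, \<open>C x = D x\<close>.

  Then all noncentral conjugacy classes have size \<open>m = |G| / N\<close>, which turns out to be coprime to
  the number \<open>t\<close> of centralizers of noncentral elements. Since \<open>m\<close> divides the number
  \<open>t (gcd N a - gcd |Z| a)\<close> of noncentral elements of the first kind, it divides
  \<open>gcd N a - gcd |Z| a\<close>, and likewise \<open>gcd N b - gcd |Z| b\<close>; this forces \<open>m |Z| < N\<close>. But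
  \<open>c\<close> divides \<open>|G| - |Z| = (m - 1) |Z| + m c\<close>, so \<open>N \<le> m |Z|\<close>, a contradiction.

  Thus \<open>Z\<close> contains all elements of order dividing \<open>a\<close> or all elements of order dividing \<open>b\<close>, so the
  index of \<open>Z\<close> divides \<open>b\<close> or \<open>a\<close>. As this holds for all coprime factorizations of \<open>|G|\<close>, the index
  is a prime power.
\<close>

section \<open>Counting and divisibility\<close>

lemma card_eq_fibre_mult_image:
  assumes "finite S" and "\<And>x. x \<in> S \<Longrightarrow> card {y \<in> S. g y = g x} = k"
  shows "card S = k * card (g ` S)"
proof -
  have "card S = (\<Sum>x\<in>S. 1)" by simp
  also have "\<dots> = (\<Sum>y\<in>g ` S. card {x \<in> S. g x = y})"
    using sum.group[of S "g ` S" g "\<lambda>_. 1::nat"] assms(1) by simp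
  also have "\<dots> = (\<Sum>y\<in>g ` S. k)"
    using assms(2) by (intro sum.cong) auto
  finally show ?thesis by simp
qed

lemma double_le_if_dvd_neq:
  fixes m n :: nat
  assumes "m dvd n" and "m \<noteq> n" and "0 < n"
  shows "2 * m \<le> n"
proof -
  obtain d where n_eq: "n = m * d" using \<open>m dvd n\<close> by blast
  with assms(2,3) have "2 \<le> d" by (cases "d = 0 \<or> d = 1") auto
  then show ?thesis using n_eq by simp
qed

lemma add_le_mult_if_dvd_diff:
  fixes c d z :: nat
  assumes "c dvd d * (z + c) - z" and "2 \<le> d" and "0 < z"
  shows "z + c \<le> d * z"
proof -
  have "d * (z + c) - z = (d - 1) * z + d * c"
    using assms(2) by (simp add: algebra_simps)
  then have "c dvd (d - 1) * z"
    using assms(1) by (simp add: dvd_add_left_iff)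
  then have "c \<le> (d - 1) * z"
    using assms(2,3) by (intro dvd_imp_le) auto
  moreover have "z + (d - 1) * z = d * z"
    using assms(2) by (simp add: algebra_simps)
  ultimately show ?thesis by linarith
qed

lemma mult_less_if_dvd_diff:
  fixes k m z :: nat
  assumes "coprime m z" and "z dvd k" and "z < k" and "m dvd k - z"
  shows "m * z < k"
proof -
  have "0 < z" using assms(2,3) by (auto intro: Nat.gr0I)
  moreover have "m * z \<le> k - z"
    using assms by (intro dvd_imp_le divides_mult) auto
  ultimately show ?thesis using assms(3) by linarith
qed

lemma mult_less_mult_if_dvd_diff:
  fixes a b m k\<^sub>a k\<^sub>b z\<^sub>a z\<^sub>b :: nat
  assumes "coprime a b" and "m dvd a * b"
    and a_part: "z\<^sub>a dvd a" "z\<^sub>a dvd k\<^sub>a" "z\<^sub>a < k\<^sub>a" "m dvd k\<^sub>a - z\<^sub>a"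
    and b_part: "z\<^sub>b dvd b" "z\<^sub>b dvd k\<^sub>b" "z\<^sub>b < k\<^sub>b" "m dvd k\<^sub>b - z\<^sub>b"
  shows "m * (z\<^sub>a * z\<^sub>b) < k\<^sub>a * k\<^sub>b"
proof -
  obtain m\<^sub>a m\<^sub>b where m_eq: "m = m\<^sub>a * m\<^sub>b" and m_dvd: "m\<^sub>a dvd a" "m\<^sub>b dvd b"
    using division_decomp[OF assms(2)] by blast
  have "coprime m\<^sub>b z\<^sub>a" "coprime m\<^sub>a z\<^sub>b"
    using assms(1) a_part(1) b_part(1) m_dvd by (meson coprime_commute coprime_divisors)+
  then have "m\<^sub>b * z\<^sub>a < k\<^sub>a" "m\<^sub>a * z\<^sub>b < k\<^sub>b"
    using a_part b_part m_eq
    by (auto intro!: mult_less_if_dvd_diff dest: dvd_mult_left dvd_mult_right)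
  then have "(m\<^sub>b * z\<^sub>a) * (m\<^sub>a * z\<^sub>b) < k\<^sub>a * k\<^sub>b"
    by (intro mult_strict_mono) auto
  then show ?thesis unfolding m_eq by (simp only: ac_simps)
qed

lemma coprime_if_mult_diff_eq:
  fixes c m t z :: nat
  assumes "m * (z + c) - z = c * t" and "z dvd c" and "0 < m" and "0 < z"
  shows "coprime m t"
proof (rule coprimeI)
  obtain k where c_eq: "c = z * k" using \<open>z dvd c\<close> by blast
  have "z * 1 \<le> m * (z + c)" using \<open>0 < m\<close> by (cases m) auto
  then have "z * (m * (1 + k)) = z * (1 + k * t)"
    using assms(1) c_eq by (simp add: algebra_simps)
  then have m_mult_eq: "m * (1 + k) = 1 + k * t"
    using \<open>0 < z\<close> by (simp only: mult_cancel1) simp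
  fix q assume "q dvd m" "q dvd t"
  then have "q dvd 1 + k * t" "q dvd k * t" using m_mult_eq by (metis dvd_mult2, simp)
  then show "q dvd 1" using dvd_add_left_iff by blast
qed

lemma prime_power_if_dvd_coprime_factor:
  fixes k n :: nat
  assumes "0 < n"
    and dvd_factor: "\<And>a b. n = a * b \<Longrightarrow> coprime a b \<Longrightarrow> k dvd a \<or> k dvd b"
  shows "\<exists>p j. Factorial_Ring.prime p \<and> k = p ^ j"
proof (cases "k = 1")
  case True
  then show ?thesis using two_is_prime_nat by (metis power_0)
next
  case False
  then obtain p where p: "Factorial_Ring.prime p" "p dvd k"
    using prime_factor_nat by blast
  obtain b where n_eq: "n = p ^ multiplicity p n * b" and not_dvd: "\<not> p dvd b"
    using multiplicity_decompose'[of n p] \<open>0 < n\<close> p(1) not_prime_unit by blast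
  have "coprime (p ^ multiplicity p n) b"
    using p(1) not_dvd by (simp add: prime_imp_coprime)
  then have "k dvd p ^ multiplicity p n"
    using dvd_factor[OF n_eq] p(2) not_dvd dvd_trans by blast
  then show ?thesis using divides_primepow_nat[OF p(1)] p(1) by blast
qed

section \<open>Centralizers and bicentralizers\<close>

context group
begin

lemma card_subgroup_dvd_card_subgroup:
  assumes "subgroup H G" and "subgroup K G" and "H \<subseteq> K"
  shows "card H dvd card K"
proof -
  interpret K: group "G\<lparr>carrier := K\<rparr>"
    using assms(2) by (rule subgroup_imp_group)
  have "card (rcosets\<^bsub>G\<lparr>carrier := K\<rparr>\<^esub> H) * card H = card K"
    using K.lagrange[OF subgroup_incl[OF assms]] by (simp add: order_def)
  then show ?thesis by (metis dvd_triv_right)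
qed

lemma double_card_le_card_if_psubgroup:
  assumes "subgroup H G" and "subgroup K G" and "H \<subset> K" and "finite K"
  shows "2 * card H \<le> card K"
proof (rule double_le_if_dvd_neq)
  show "card H dvd card K"
    using assms by (intro card_subgroup_dvd_card_subgroup) auto
  show "card H \<noteq> card K" "0 < card K"
    using psubset_card_mono[OF assms(4,3)] by auto
qed

lemma conj_notin_normal:
  assumes "N \<lhd> G" and g: "g \<in> carrier G" and x: "x \<in> carrier G - N"
  shows "g \<otimes> x \<otimes> inv g \<notin> N"
proof
  assume "g \<otimes> x \<otimes> inv g \<in> N"
  then have "inv g \<otimes> (g \<otimes> x \<otimes> inv g) \<otimes> g \<in> N"
    by (rule normal.inv_op_closed1[OF assms(1) g])
  moreover have "inv g \<otimes> (g \<otimes> x \<otimes> inv g) \<otimes> g = inv g \<otimes> g \<otimes> x \<otimes> (inv g \<otimes> g)"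
    using g x by (simp only: m_assoc m_closed inv_closed DiffD1)
  ultimately show False using g x by simp
qed

lemma stabilizer_conjugation:
  assumes "x \<in> carrier G"
  shows "stabilizer G (\<lambda>g. \<lambda>h \<in> carrier G. g \<otimes> h \<otimes> inv g) x = centralizer G x"
proof -
  have "g \<otimes> x \<otimes> inv g = x \<longleftrightarrow> x \<otimes> g = g \<otimes> x" if "g \<in> carrier G" for g
    using that assms by (metis inv_solve_right m_closed)
  then show ?thesis
    using assms unfolding stabilizer_def centralizer_def by auto
qed

lemma subgroup_centralizer:
  assumes "x \<in> carrier G"
  shows "subgroup (centralizer G x) G"
  using group_action.stabilizer_subgroup[OF action_by_conjugation assms]
  by (simp add: stabilizer_conjugation assms)

lemma card_conj_closed:
  assumes finite_G: "finite (carrier G)" and E_subset: "E \<subseteq> carrier G"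
    and conj: "\<And>g x. g \<in> carrier G \<Longrightarrow> x \<in> E \<Longrightarrow> g \<otimes> x \<otimes> inv g \<in> E"
    and card_centralizer: "\<And>x. x \<in> E \<Longrightarrow> card (centralizer G x) = k"
    and order: "order G = m * k"
  shows "m dvd card E"
proof -
  let ?\<phi> = "\<lambda>g. \<lambda>h \<in> carrier G. g \<otimes> h \<otimes> inv g"
  interpret act: group_action G "carrier G" ?\<phi> by (rule action_by_conjugation)
  have "k \<noteq> 0" using order finite_G order_gt_0_iff_finite by auto
  have orbit_subset: "orbit G ?\<phi> x \<subseteq> E" if "x \<in> E" for x
    using that E_subset conj by (auto simp: orbit_def)
  have "\<Union> (orbit G ?\<phi> ` E) = E"
    using orbit_subset act.orbit_refl E_subset by blast
  moreover have "m dvd card (\<Union> (orbit G ?\<phi> ` E))"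
  proof (rule dvd_partition)
    show "\<forall>A \<in> orbit G ?\<phi> ` E. m dvd card A"
    proof
      fix A assume "A \<in> orbit G ?\<phi> ` E"
      then obtain x where x: "x \<in> E" "A = orbit G ?\<phi> x" by blast
      then have "card A * k = m * k"
        using act.orbit_stabilizer_theorem[of x] stabilizer_conjugation[of x]
          card_centralizer[OF x(1)] order E_subset by auto
      then show "m dvd card A" using \<open>k \<noteq> 0\<close> by simp
    qed
    show "\<forall>A \<in> orbit G ?\<phi> ` E. \<forall>B \<in> orbit G ?\<phi> ` E. A \<noteq> B \<longrightarrow> A \<inter> B = {}"
      using act.disjoint_union E_subset unfolding orbits_def by blast
    show "finite (\<Union> (orbit G ?\<phi> ` E))"
      using \<open>\<Union> (orbit G ?\<phi> ` E) = E\<close> finite_subset[OF E_subset finite_G] by simp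
  qed
  ultimately show ?thesis by simp
qed

lemma centralizer_subset_carrier: "centralizer G x \<subseteq> carrier G"
  by (auto simp: centralizer_def)

lemma mem_centralizer_commute:
  assumes "x \<in> carrier G" and "y \<in> carrier G"
  shows "x \<in> centralizer G y \<longleftrightarrow> y \<in> centralizer G x"
  using assms by (auto simp: centralizer_def)

lemma mem_group_center_iff:
  "x \<in> group_center G \<longleftrightarrow> x \<in> carrier G \<and> centralizer G x = carrier G"
  unfolding group_center_def centralizer_def by auto

lemma centralizer_Int_subset_mult:
  assumes "u \<in> carrier G" and "v \<in> carrier G"
  shows "centralizer G u \<inter> centralizer G v \<subseteq> centralizer G (u \<otimes> v)"
proof
  fix y assume y: "y \<in> centralizer G u \<inter> centralizer G v"
  then have y_carrier: "y \<in> carrier G" using centralizer_subset_carrier by blast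
  then have "u \<in> centralizer G y" "v \<in> centralizer G y"
    using y assms mem_centralizer_commute by auto
  then have "u \<otimes> v \<in> centralizer G y"
    by (rule subgroup.m_closed[OF subgroup_centralizer[OF y_carrier]])
  then show "y \<in> centralizer G (u \<otimes> v)"
    using mem_centralizer_commute y_carrier assms by simp
qed

text \<open>The double centralizer of \<open>x\<close>, which is the center of the centralizer of \<open>x\<close>.\<close>

definition bicentralizer :: "'a \<Rightarrow> 'a set" where
  "bicentralizer x = {y \<in> carrier G. centralizer G x \<subseteq> centralizer G y}"

definition commutative_subgroup :: "'a set \<Rightarrow> bool" where
  "commutative_subgroup H \<longleftrightarrow> subgroup H G \<and> (\<forall>x \<in> H. \<forall>y \<in> H. x \<otimes> y = y \<otimes> x)"

lemma commutative_subgroup_imp_subgroup: "commutative_subgroup H \<Longrightarrow> subgroup H G"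
  by (simp add: commutative_subgroup_def)

lemma bicentralizer_subset_carrier: "bicentralizer x \<subseteq> carrier G"
  by (auto simp: bicentralizer_def)

lemma self_mem_bicentralizer: "x \<in> carrier G \<Longrightarrow> x \<in> bicentralizer x"
  by (simp add: bicentralizer_def)

lemma bicentralizer_mono: "y \<in> bicentralizer x \<Longrightarrow> bicentralizer y \<subseteq> bicentralizer x"
  by (auto simp: bicentralizer_def)

lemma bicentralizer_subset_centralizer:
  assumes "x \<in> carrier G"
  shows "bicentralizer x \<subseteq> centralizer G x"
  using assms by (auto simp: bicentralizer_def centralizer_def)

lemma subgroup_bicentralizer:
  assumes "x \<in> carrier G"
  shows "subgroup (bicentralizer x) G"
proof -
  have one: "\<one> \<in> centralizer G x"
    using assms by (simp add: centralizer_def)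
  then have "bicentralizer x = \<Inter> (centralizer G ` centralizer G x)"
    using mem_centralizer_commute subsetD[OF centralizer_subset_carrier]
    unfolding bicentralizer_def by blast
  then show ?thesis
    using one subgroup_centralizer subsetD[OF centralizer_subset_carrier]
    by (auto intro!: subgroups_Inter)
qed

lemma commutative_subgroup_bicentralizer:
  assumes "x \<in> carrier G"
  shows "commutative_subgroup (bicentralizer x)"
  using assms subgroup_bicentralizer bicentralizer_subset_centralizer[OF assms]
  unfolding commutative_subgroup_def bicentralizer_def centralizer_def by blast

lemma group_center_subset_bicentralizer: "group_center G \<subseteq> bicentralizer x"
  unfolding bicentralizer_def group_center_def centralizer_def by auto

lemma commutative_subgroup_group_center: "commutative_subgroup (group_center G)"
proof -
  have "group_center G = bicentralizer \<one>"
    unfolding group_center_def bicentralizer_def centralizer_def by auto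
  then show ?thesis by (simp add: commutative_subgroup_bicentralizer)
qed

lemmas subgroup_group_center =
  commutative_subgroup_imp_subgroup[OF commutative_subgroup_group_center]

lemma normal_group_center: "group_center G \<lhd> G"
  unfolding normal_inv_iff
proof (intro conjI ballI subgroup_group_center)
  fix g z assume g: "g \<in> carrier G" and z: "z \<in> group_center G"
  then have "g \<otimes> z = z \<otimes> g" and "z \<in> carrier G"
    by (auto simp: group_center_def)
  then have "g \<otimes> z \<otimes> inv g = z"
    using g by (simp add: m_assoc)
  then show "g \<otimes> z \<otimes> inv g \<in> group_center G"
    using z by simp
qed

definition maximal_centralizer :: "'a \<Rightarrow> bool" where
  "maximal_centralizer x \<longleftrightarrow> x \<in> carrier G - group_center G \<and>
    (\<forall>y \<in> carrier G - group_center G.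
      centralizer G x \<subseteq> centralizer G y \<longrightarrow> centralizer G y = centralizer G x)"

lemma maximal_centralizer_noncentral:
  "maximal_centralizer x \<Longrightarrow> x \<in> carrier G - group_center G"
  by (simp add: maximal_centralizer_def)

lemma centralizer_eq_if_maximal:
  assumes "maximal_centralizer x" and "y \<in> bicentralizer x - group_center G"
  shows "centralizer G y = centralizer G x"
  using assms unfolding maximal_centralizer_def bicentralizer_def by blast

lemma maximal_centralizer_if_eq_bicentralizer:
  assumes commutative: "\<And>h. h \<in> carrier G - group_center G \<Longrightarrow> centralizer G h = bicentralizer h"
    and x: "x \<in> carrier G - group_center G"
  shows "maximal_centralizer x"
  unfolding maximal_centralizer_def
proof (intro conjI ballI impI x)
  fix y assume y: "y \<in> carrier G - group_center G"
    and subset: "centralizer G x \<subseteq> centralizer G y"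
  have "x \<in> centralizer G x" using x by (simp add: centralizer_def)
  then have "x \<in> bicentralizer y" using subset commutative[OF y] by blast
  then have "centralizer G y \<subseteq> centralizer G x"
    by (simp add: bicentralizer_def)
  then show "centralizer G y = centralizer G x" using subset by blast
qed

definition centralizer_class :: "'a \<Rightarrow> 'a set" where
  "centralizer_class x = {y \<in> carrier G. centralizer G y = centralizer G x}"

lemma centralizer_class_subset:
  assumes "x \<in> carrier G - group_center G"
  shows "centralizer_class x \<subseteq> bicentralizer x - group_center G"
  using assms mem_group_center_iff by (auto simp: centralizer_class_def bicentralizer_def)

lemma maximal_centralizer_iff_class:
  assumes x: "x \<in> carrier G - group_center G"
  shows "maximal_centralizer x \<longleftrightarrow> centralizer_class x = bicentralizer x - group_center G"
proof -
  have "maximal_centralizer x \<longleftrightarrow> bicentralizer x - group_center G \<subseteq> centralizer_class x"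
    using x unfolding maximal_centralizer_def bicentralizer_def centralizer_class_def by blast
  then show ?thesis using centralizer_class_subset[OF x] by blast
qed

definition submaximal_centralizer :: "'a \<Rightarrow> bool" where
  "submaximal_centralizer x \<longleftrightarrow> x \<in> carrier G - group_center G \<and> \<not> maximal_centralizer x \<and>
    (\<forall>y \<in> bicentralizer x - group_center G.
      centralizer G y = centralizer G x \<or> maximal_centralizer y)"

lemma submaximal_centralizer_noncentral:
  "submaximal_centralizer x \<Longrightarrow> x \<in> carrier G - group_center G"
  by (simp add: submaximal_centralizer_def)

lemma ex_centralizer_maximal_on:
  assumes "finite S" and "x \<in> S"
  obtains y where "y \<in> S" and "centralizer G x \<subseteq> centralizer G y"
    and "\<And>w. w \<in> S \<Longrightarrow> centralizer G y \<subseteq> centralizer G w \<Longrightarrow> centralizer G w = centralizer G y"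
proof -
  obtain y where "y \<in> S" "centralizer G x \<subseteq> centralizer G y"
    and "\<forall>w \<in> S. centralizer G y \<subseteq> centralizer G w \<longrightarrow> centralizer G y = centralizer G w"
    using finite_has_maximal2[of "centralizer G ` S" "centralizer G x"] assms by auto
  then show thesis by (intro that) auto
qed

lemma ex_maximal_centralizer:
  assumes "finite (carrier G)" and "x \<in> carrier G - group_center G"
  obtains y where "maximal_centralizer y" and "y \<in> bicentralizer x"
proof -
  obtain y where y: "y \<in> carrier G - group_center G" "centralizer G x \<subseteq> centralizer G y"
    and "\<And>w. w \<in> carrier G - group_center G \<Longrightarrow>
      centralizer G y \<subseteq> centralizer G w \<Longrightarrow> centralizer G w = centralizer G y"
    using ex_centralizer_maximal_on[of "carrier G - group_center G" x] assms
    by (metis finite_Diff)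
  then have "maximal_centralizer y"
    unfolding maximal_centralizer_def by blast
  then show thesis using y by (intro that) (auto simp: bicentralizer_def)
qed

lemma ex_submaximal_centralizer:
  assumes "finite (carrier G)" and "x \<in> carrier G - group_center G" and "\<not> maximal_centralizer x"
  obtains y where "submaximal_centralizer y"
proof -
  let ?S = "{y \<in> carrier G - group_center G. \<not> maximal_centralizer y}"
  have "finite ?S" "x \<in> ?S" using assms by auto
  then obtain y where "y \<in> ?S" "centralizer G x \<subseteq> centralizer G y"
    and "\<And>w. w \<in> ?S \<Longrightarrow> centralizer G y \<subseteq> centralizer G w \<Longrightarrow> centralizer G w = centralizer G y"
    using ex_centralizer_maximal_on[of ?S x] by blast
  then show thesis
    by (intro that) (auto simp: submaximal_centralizer_def bicentralizer_def)
qed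

section \<open>Torsion elements of coprime exponents\<close>

definition torsion :: "'a set \<Rightarrow> nat \<Rightarrow> 'a set" where
  "torsion H k = {h \<in> H. h [^] k = \<one>}"

lemma torsion_mono: "H \<subseteq> K \<Longrightarrow> torsion H k \<subseteq> torsion K k"
  by (auto simp: torsion_def)

lemma torsion_subset: "torsion H k \<subseteq> H"
  by (auto simp: torsion_def)

lemma subgroup_torsion:
  assumes "commutative_subgroup H"
  shows "subgroup (torsion H k) G"
proof -
  have subgroup_H: "subgroup H G" and comm: "\<And>x y. x \<in> H \<Longrightarrow> y \<in> H \<Longrightarrow> x \<otimes> y = y \<otimes> x"
    using assms by (auto simp: commutative_subgroup_def)
  note H_carrier = subgroup.mem_carrier[OF subgroup_H]
  show ?thesis
  proof
    fix x y assume "x \<in> torsion H k" "y \<in> torsion H k"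
    then show "x \<otimes> y \<in> torsion H k"
      by (simp add: torsion_def H_carrier comm pow_mult_distrib subgroup.m_closed[OF subgroup_H])
  next
    fix x assume "x \<in> torsion H k"
    then show "inv x \<in> torsion H k"
      by (simp add: torsion_def H_carrier nat_pow_inv subgroup.m_inv_closed[OF subgroup_H])
  qed (auto simp: torsion_def H_carrier subgroup.one_closed[OF subgroup_H])
qed

lemma conj_mem_torsion:
  assumes "g \<in> carrier G" and "x \<in> torsion (carrier G) k"
  shows "g \<otimes> x \<otimes> inv g \<in> torsion (carrier G) k"
proof -
  have "(\<lambda>h. g \<otimes> h \<otimes> inv g) \<in> hom G G"
  proof (rule homI)
    fix x y assume xy: "x \<in> carrier G" "y \<in> carrier G"
    have "g \<otimes> x \<otimes> inv g \<otimes> (g \<otimes> y \<otimes> inv g) = g \<otimes> x \<otimes> (inv g \<otimes> g) \<otimes> y \<otimes> inv g"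
      using assms(1) xy by (simp only: m_assoc m_closed inv_closed)
    then show "g \<otimes> (x \<otimes> y) \<otimes> inv g = g \<otimes> x \<otimes> inv g \<otimes> (g \<otimes> y \<otimes> inv g)"
      using assms(1) xy by (simp add: m_assoc)
  qed (use assms(1) in simp)
  then have "g \<otimes> x [^] k \<otimes> inv g = (g \<otimes> x \<otimes> inv g) [^] k"
    using assms(2) by (intro hom_nat_pow) (auto simp: torsion_def)
  then show ?thesis using assms by (auto simp: torsion_def)
qed

lemma coprime_order_if_torsion:
  assumes finite_G: "finite (carrier G)" and torsion: "torsion (carrier G) a = carrier G"
    and "coprime a b"
  shows "coprime (order G) b"
proof (rule ccontr)
  assume "\<not> coprime (order G) b"
  then have "gcd (order G) b \<noteq> 1" by (simp add: coprime_iff_gcd_eq_1)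
  then obtain q where q: "Factorial_Ring.prime q" "q dvd order G" "q dvd b"
    using prime_factor_nat[of "gcd (order G) b"] by (meson gcd_greatest_iff)
  obtain K where K: "subgroup K G" "card K = q"
    using sylow_thm[OF q(1) is_group _ finite_G, of 1 "order G div q"] q(2) by auto
  interpret K: group "G\<lparr>carrier := K\<rparr>" using K(1) by (rule subgroup_imp_group)
  have "K \<noteq> {\<one>}" using q(1) K(2) by auto
  then obtain x where x: "x \<in> K" "x \<noteq> \<one>"
    using subgroup.one_closed[OF K(1)] by blast
  then have x_carrier: "x \<in> carrier G" using subgroup.mem_carrier[OF K(1)] by blast
  have "x [^] q = \<one>"
    using K.pow_order_eq_1[of x] x(1) K(2) by (simp add: order_def flip: nat_pow_consistent)
  moreover have "x [^] a = \<one>" using torsion x_carrier by (auto simp: torsion_def)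
  ultimately have "ord x dvd q" "ord x dvd a" using x_carrier pow_eq_id by auto
  moreover have "coprime q a"
    using \<open>coprime a b\<close> q(3) by (meson coprime_commute coprime_divisors dvd_refl)
  ultimately have "ord x = 1" using coprime_common_divisor_nat by blast
  then show False using x x_carrier ord_eq_1 by blast
qed

lemma int_pow_mult_eq_one:
  assumes "x \<in> carrier G" and "x [^] n = \<one>"
  shows "x [^] (int n * k) = \<one>"
  using assms int_pow_pow[of x "int n" k] by (simp add: int_pow_int)

lemma coprime_projection:
  assumes "coprime a b"
  obtains i :: int where
    "\<And>u v. \<lbrakk>u \<in> torsion (carrier G) a; v \<in> torsion (carrier G) b; u \<otimes> v = v \<otimes> u\<rbrakk>
      \<Longrightarrow> (u \<otimes> v) [^] i = u"
proof -
  obtain r s where bezout: "r * int a + s * int b = 1"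
    using bezout_int[of "int a" "int b"] assms by (auto simp: coprime_iff_gcd_eq_1)
  show thesis
  proof (rule that[of "int b * s"])
    fix u v assume u: "u \<in> torsion (carrier G) a" and v: "v \<in> torsion (carrier G) b"
      and comm: "u \<otimes> v = v \<otimes> u"
    have u_carrier: "u \<in> carrier G" and v_carrier: "v \<in> carrier G"
      using u v by (auto simp: torsion_def)
    have "u = u [^] (int a * r + int b * s)"
      using bezout u_carrier by (simp add: mult.commute)
    also have "\<dots> = u [^] (int b * s)"
      using u u_carrier by (simp add: int_pow_mult int_pow_mult_eq_one torsion_def)
    finally show "(u \<otimes> v) [^] (int b * s) = u"
      using v u_carrier v_carrier
      by (simp add: int_pow_mult_distrib[OF comm] int_pow_mult_eq_one torsion_def)
  qed
qed

lemma centralizer_mult_coprime_subset: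
  assumes "coprime a b" and u: "u \<in> torsion (carrier G) a" and v: "v \<in> torsion (carrier G) b"
    and comm: "u \<otimes> v = v \<otimes> u"
  shows "centralizer G (u \<otimes> v) \<subseteq> centralizer G u"
proof
  obtain i :: int where projection: "(u \<otimes> v) [^] i = u"
    using coprime_projection[OF assms(1)] u v comm by metis
  have u_carrier: "u \<in> carrier G" and mult_carrier: "u \<otimes> v \<in> carrier G"
    using u v by (auto simp: torsion_def)
  fix y assume y: "y \<in> centralizer G (u \<otimes> v)"
  then have y_carrier: "y \<in> carrier G" using centralizer_subset_carrier by blast
  have "u \<otimes> v \<in> centralizer G y" using y mem_centralizer_commute[OF mult_carrier y_carrier] by blast
  then have "u \<in> centralizer G y"
    using subgroup_int_pow_closed[OF subgroup_centralizer[OF y_carrier]] projection by metis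
  then show "y \<in> centralizer G u" using mem_centralizer_commute[OF u_carrier y_carrier] by blast
qed

lemma centralizer_mult_coprime:
  assumes "coprime a b" and u: "u \<in> torsion (carrier G) a" and v: "v \<in> torsion (carrier G) b"
    and "u \<otimes> v = v \<otimes> u"
  shows "centralizer G (u \<otimes> v) = centralizer G u \<inter> centralizer G v"
proof
  show "centralizer G (u \<otimes> v) \<subseteq> centralizer G u \<inter> centralizer G v"
    using centralizer_mult_coprime_subset[OF assms]
      centralizer_mult_coprime_subset[of b a v u] assms by (simp add: coprime_commute)
  show "centralizer G u \<inter> centralizer G v \<subseteq> centralizer G (u \<otimes> v)"
    using u v by (intro centralizer_Int_subset_mult) (auto simp: torsion_def)
qed

lemma centralizer_mult_torsion:
  assumes "commutative_subgroup H" and "coprime a b"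
    and u: "u \<in> torsion H a" and v: "v \<in> torsion H b"
  shows "centralizer G (u \<otimes> v) = centralizer G u \<inter> centralizer G v"
proof -
  have "H \<subseteq> carrier G" and "u \<otimes> v = v \<otimes> u"
    using assms subgroup.subset torsion_subset unfolding commutative_subgroup_def by blast+
  then show ?thesis
    using u v by (intro centralizer_mult_coprime[OF assms(2)]) (auto simp: torsion_def)
qed

lemma mult_mem_centralizer_class:
  assumes x: "x \<in> carrier G" and "coprime a b"
    and u: "u \<in> torsion (bicentralizer x) a" and v: "v \<in> torsion (bicentralizer x) b"
    and "centralizer G u = centralizer G x"
  shows "u \<otimes> v \<in> centralizer_class x"
  using centralizer_mult_torsion[OF commutative_subgroup_bicentralizer[OF x] assms(2) u v]
    assms(5) u v
  by (auto simp: centralizer_class_def torsion_def bicentralizer_def)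

lemma inj_on_mult_torsion:
  assumes "commutative_subgroup H" and "coprime a b"
  shows "inj_on (\<lambda>(u, v). u \<otimes> v) (torsion H a \<times> torsion H b)"
proof -
  have comm: "\<And>x y. x \<in> H \<Longrightarrow> y \<in> H \<Longrightarrow> x \<otimes> y = y \<otimes> x" and H_carrier: "H \<subseteq> carrier G"
    using assms(1) subgroup.subset by (auto simp: commutative_subgroup_def)
  obtain i :: int where projection: "\<And>u v. \<lbrakk>u \<in> torsion H a; v \<in> torsion H b\<rbrakk> \<Longrightarrow> (u \<otimes> v) [^] i = u"
    using coprime_projection[OF assms(2)] torsion_mono[OF H_carrier] torsion_subset comm
    by (metis subset_iff)
  have "u = u' \<and> v = v'"
    if "u \<in> torsion H a" "v \<in> torsion H b" "u' \<in> torsion H a" "v' \<in> torsion H b"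
      and "u \<otimes> v = u' \<otimes> v'" for u v u' v'
  proof -
    have "u = u'" using projection that by metis
    then show ?thesis using that H_carrier torsion_subset by (auto simp: subset_iff)
  qed
  then show ?thesis by (auto simp: inj_on_def)
qed

lemma card_torsion_pairs_le:
  assumes commutative_coprime: "commutative_subgroup H" "coprime a b"
    and R_subset: "R \<subseteq> torsion H a \<times> torsion H b"
    and mult: "\<And>u v. (u, v) \<in> R \<Longrightarrow> u \<otimes> v \<in> K" and "finite K"
  shows "card R \<le> card K"
proof (rule card_inj_on_le)
  show "inj_on (\<lambda>(u, v). u \<otimes> v) R"
    using inj_on_mult_torsion[OF commutative_coprime] R_subset by (rule inj_on_subset)
qed (use mult \<open>finite K\<close> in auto)

lemma mem_bicentralizer_if_coprime:
  assumes maximal: "\<And>x. x \<in> carrier G - group_center G \<Longrightarrow> maximal_centralizer x"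
    and "coprime a b" and u: "u \<in> torsion (centralizer G h) a"
    and v: "v \<in> torsion (bicentralizer h) b - group_center G"
    and h: "h \<in> carrier G - group_center G"
  shows "u \<in> bicentralizer h"
proof (cases "u \<in> group_center G")
  case True
  then show ?thesis using group_center_subset_bicentralizer by blast
next
  case False
  have u_torsion: "u \<in> torsion (carrier G) a" and v_torsion: "v \<in> torsion (carrier G) b"
    using u v torsion_mono centralizer_subset_carrier bicentralizer_subset_carrier by blast+
  have C_v: "centralizer G v = centralizer G h"
    using centralizer_eq_if_maximal[OF maximal[OF h], of v] v torsion_subset by blast
  then have "u \<in> centralizer G v" using u torsion_subset by blast
  then have C_mult: "centralizer G (u \<otimes> v) = centralizer G u \<inter> centralizer G v"
    by (intro centralizer_mult_coprime[OF \<open>coprime a b\<close> u_torsion v_torsion])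
      (simp add: centralizer_def)
  moreover have carriers: "u \<in> carrier G" "v \<in> carrier G" "u \<otimes> v \<in> carrier G"
    using u_torsion v_torsion by (auto simp: torsion_def)
  ultimately have "u \<otimes> v \<notin> group_center G"
    using v centralizer_subset_carrier[of v] mem_group_center_iff by auto
  then have "maximal_centralizer (u \<otimes> v)" using maximal carriers by blast
  then have "centralizer G u = centralizer G (u \<otimes> v)" "centralizer G v = centralizer G (u \<otimes> v)"
    using False v carriers C_mult unfolding maximal_centralizer_def by blast+
  then show ?thesis using C_v carriers by (simp add: bicentralizer_def)
qed

end

locale finite_group = group G for G (structure) +
  assumes finite_carrier: "finite (carrier G)"
begin

abbreviation Z :: "'a set" where "Z \<equiv> group_center G"

abbreviation C :: "'a \<Rightarrow> 'a set" where "C \<equiv> centralizer G"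

lemma finite_subset_carrier: "H \<subseteq> carrier G \<Longrightarrow> finite H"
  using finite_carrier by (rule rev_finite_subset)

lemma order_pos: "0 < order G"
  using finite_carrier order_gt_0_iff_finite by simp

lemmas finite_group_center = finite_subset_carrier[OF subgroup.subset[OF subgroup_group_center]]

lemmas finite_bicentralizer = finite_subset_carrier[OF bicentralizer_subset_carrier]

lemma card_group_center_pos: "0 < card Z"
  using finite_group_center subgroup.one_closed[OF subgroup_group_center]
  by (auto simp: card_gt_0_iff)

end

section \<open>Groups whose order splits into coprime factors\<close>

locale coprime_order_group = finite_group G for G (structure) +
  fixes a b :: nat
  assumes order_eq: "order G = a * b" and coprime_ab: "coprime a b"
begin

lemma coprime_order_group_swap: "coprime_order_group G b a"
  using order_eq coprime_ab by unfold_locales (simp_all add: mult.commute coprime_commute)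

lemma ex_coprime_parts:
  assumes subgroup_H: "subgroup H G" and x: "x \<in> H"
  obtains u v where "u \<in> torsion H a" and "v \<in> torsion H b" and "x = u \<otimes> v"
proof -
  obtain r s where bezout: "r * int a + s * int b = 1"
    using bezout_int[of "int a" "int b"] coprime_ab by (auto simp: coprime_iff_gcd_eq_1)
  have x_carrier: "x \<in> carrier G" using subgroup_H x by (rule subgroup.mem_carrier)
  have "(x [^] (s * int b)) [^] a = x [^] (int (order G) * s)"
    "(x [^] (r * int a)) [^] b = x [^] (int (order G) * r)"
    using x_carrier order_eq by (simp_all add: int_pow_pow ac_simps flip: int_pow_int)
  then have powers: "(x [^] (s * int b)) [^] a = \<one>" "(x [^] (r * int a)) [^] b = \<one>"
    using int_pow_mult_eq_one[OF x_carrier pow_order_eq_1[OF x_carrier]] by simp_all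
  show thesis
  proof (rule that)
    show "x [^] (s * int b) \<in> torsion H a"
      using subgroup_int_pow_closed[OF subgroup_H x] powers(1) by (simp add: torsion_def)
    show "x [^] (r * int a) \<in> torsion H b"
      using subgroup_int_pow_closed[OF subgroup_H x] powers(2) by (simp add: torsion_def)
    show "x = x [^] (s * int b) \<otimes> x [^] (r * int a)"
      using bezout x_carrier by (simp add: add.commute flip: int_pow_mult)
  qed
qed

lemma card_eq_card_torsion_mult:
  assumes "commutative_subgroup H"
  shows "card H = card (torsion H a) * card (torsion H b)"
proof -
  have subgroup_H: "subgroup H G" using assms by (rule commutative_subgroup_imp_subgroup)
  have "H = (\<lambda>(u, v). u \<otimes> v) ` (torsion H a \<times> torsion H b)"
  proof
    show "H \<subseteq> (\<lambda>(u, v). u \<otimes> v) ` (torsion H a \<times> torsion H b)"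
    proof
      fix x assume "x \<in> H"
      then obtain u v where "u \<in> torsion H a" "v \<in> torsion H b" "x = u \<otimes> v"
        by (rule ex_coprime_parts[OF subgroup_H])
      then show "x \<in> (\<lambda>(u, v). u \<otimes> v) ` (torsion H a \<times> torsion H b)" by auto
    qed
    show "(\<lambda>(u, v). u \<otimes> v) ` (torsion H a \<times> torsion H b) \<subseteq> H"
      using subgroup.m_closed[OF subgroup_H] by (auto simp: torsion_def)
  qed
  then have "card H = card (torsion H a \<times> torsion H b)"
    using card_image[OF inj_on_mult_torsion[OF assms coprime_ab]] by simp
  then show ?thesis by (simp add: card_cartesian_product)
qed

lemma card_torsion_dvd:
  assumes "commutative_subgroup H"
  shows "card (torsion H a) dvd a"
proof -
  let ?T = "torsion H a"
  have subgroup_T: "subgroup ?T G" using assms by (rule subgroup_torsion)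
  interpret T: group "G\<lparr>carrier := ?T\<rparr>" using subgroup_T by (rule subgroup_imp_group)
  have "T.torsion ?T a = ?T"
    unfolding T.torsion_def by (auto simp: torsion_def simp flip: nat_pow_consistent)
  then have "coprime (card ?T) b"
    using T.coprime_order_if_torsion[of a b] coprime_ab
      finite_subset_carrier[OF subgroup.subset[OF subgroup_T]]
    by (simp add: order_def)
  moreover have "card ?T dvd a * b"
    using lagrange[OF subgroup_T] order_eq by (metis dvd_triv_right)
  ultimately show ?thesis by (simp add: coprime_dvd_mult_left_iff)
qed

lemma card_torsion:
  assumes "commutative_subgroup H"
  shows "card (torsion H a) = gcd (card H) a"
proof -
  interpret swap: coprime_order_group G b a by (rule coprime_order_group_swap)
  have "coprime (card (torsion H b)) a"
    using swap.card_torsion_dvd[OF assms] coprime_ab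
    by (meson coprime_commute coprime_divisors dvd_refl)
  then have "gcd (card H) a = gcd (card (torsion H a)) a"
    using gcd_mult_left_right_cancel[of a "card (torsion H b)" "card (torsion H a)"]
    by (simp add: card_eq_card_torsion_mult[OF assms] ac_simps)
  then show ?thesis
    using card_torsion_dvd[OF assms] by (simp add: gcd_nat.absorb1)
qed

lemma card_eq_gcd_mult_gcd:
  assumes "commutative_subgroup H"
  shows "card H = gcd (card H) a * gcd (card H) b"
  using card_eq_card_torsion_mult[OF assms] card_torsion[OF assms]
    coprime_order_group.card_torsion[OF coprime_order_group_swap assms] by simp

lemma card_torsion_minus_center:
  assumes "commutative_subgroup H" and "Z \<subseteq> H"
  shows "card (torsion H a - Z) = gcd (card H) a - gcd (card Z) a"
proof -
  have "torsion H a - Z = torsion H a - torsion Z a"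
    using torsion_subset by (auto simp: torsion_def)
  then show ?thesis
    using torsion_mono[OF assms(2)] finite_subset[OF torsion_subset finite_group_center]
    by (simp add: card_Diff_subset card_torsion assms(1) commutative_subgroup_group_center)
qed

lemma double_gcd_card_center_le:
  assumes commutative: "commutative_subgroup H" and "Z \<subseteq> H" and noncentral: "\<not> torsion H a \<subseteq> Z"
  shows "2 * gcd (card Z) a \<le> gcd (card H) a"
proof -
  have "torsion Z a \<subset> torsion H a"
    using torsion_mono[OF \<open>Z \<subseteq> H\<close>] noncentral torsion_subset by blast
  moreover have "subgroup (torsion Z a) G" "subgroup (torsion H a) G"
    using commutative commutative_subgroup_group_center by (auto intro: subgroup_torsion)
  ultimately have "2 * card (torsion Z a) \<le> card (torsion H a)"
    using finite_subset_carrier subgroup.subset double_card_le_card_if_psubgroup by metis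
  then show ?thesis
    by (simp add: card_torsion commutative commutative_subgroup_group_center)
qed

lemma torsion_FactGroup:
  assumes normal: "N \<lhd> G" and torsion_subset_N: "torsion (carrier G) b \<subseteq> N"
  shows "group.torsion (G Mod N) (carrier (G Mod N)) a = carrier (G Mod N)"
proof -
  interpret normal N G by (rule normal)
  interpret quotient: group "G Mod N" by (rule factorgroup_is_group)
  interpret coset: group_hom G "G Mod N" "\<lambda>x. N #> x"
    using r_coset_hom_Mod by unfold_locales
  have "A [^]\<^bsub>G Mod N\<^esub> a = \<one>\<^bsub>G Mod N\<^esub>" if in_quotient: "A \<in> carrier (G Mod N)" for A
  proof -
    obtain x where x: "x \<in> carrier G" "A = N #> x"
      using in_quotient by (auto simp: carrier_FactGroup)
    obtain u v where u: "u \<in> torsion (carrier G) a" and v: "v \<in> torsion (carrier G) b"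
      and x_eq: "x = u \<otimes> v"
      using ex_coprime_parts[OF subgroup_self x(1)] .
    have carr: "u \<in> carrier G" and "v \<in> N"
      using u v torsion_subset_N by (auto simp: torsion_def)
    then have "A = N #> u"
      using x(2) x_eq coset.hom_mult[of u v] rcos_const[OF is_group]
        quotient.r_one[OF coset.hom_closed[OF carr]] subset by (simp add: subset_iff)
    then have "A [^]\<^bsub>G Mod N\<^esub> a = N #> (u [^] a)"
      using coset.hom_nat_pow[OF carr] by simp
    then show ?thesis using u by (simp add: torsion_def)
  qed
  then show ?thesis by (auto simp: quotient.torsion_def)
qed

lemma index_dvd_if_torsion_subset:
  assumes normal: "N \<lhd> G" and "torsion (carrier G) b \<subseteq> N"
  shows "card (rcosets N) dvd a"
proof -
  interpret quotient: group "G Mod N" using normal by (rule normal.factorgroup_is_group)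
  have order: "order (G Mod N) = card (rcosets N)"
    by (simp add: order_def FactGroup_def)
  then have "order (G Mod N) dvd a * b"
    using lagrange[OF normal_imp_subgroup[OF normal]] order_eq by (metis dvd_triv_left)
  moreover have "finite (carrier (G Mod N))"
    using finite_carrier by (simp add: carrier_FactGroup)
  then have "coprime (order (G Mod N)) b"
    using quotient.coprime_order_if_torsion torsion_FactGroup[OF assms] coprime_ab by blast
  ultimately show ?thesis using order by (simp add: coprime_dvd_mult_left_iff)
qed

lemma centralizer_eq_bicentralizer:
  assumes maximal: "\<And>x. x \<in> carrier G - Z \<Longrightarrow> maximal_centralizer x"
    and h: "h \<in> carrier G - Z"
    and noncentral_a: "\<not> torsion (bicentralizer h) a \<subseteq> Z"
    and noncentral_b: "\<not> torsion (bicentralizer h) b \<subseteq> Z"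
  shows "C h = bicentralizer h"
proof
  have h_carrier: "h \<in> carrier G" using h by simp
  show "bicentralizer h \<subseteq> C h" using h_carrier by (rule bicentralizer_subset_centralizer)
  show "C h \<subseteq> bicentralizer h"
  proof
    fix g assume "g \<in> C h"
    then obtain u v where u: "u \<in> torsion (C h) a" and v: "v \<in> torsion (C h) b"
      and g_eq: "g = u \<otimes> v"
      using ex_coprime_parts[OF subgroup_centralizer[OF h_carrier]] by blast
    have "u \<in> bicentralizer h"
      using mem_bicentralizer_if_coprime[OF maximal coprime_ab u _ h] noncentral_b by blast
    moreover have "v \<in> bicentralizer h"
      using mem_bicentralizer_if_coprime[OF maximal _ v _ h] noncentral_a coprime_ab coprime_commute
      by blast
    ultimately show "g \<in> bicentralizer h"
      unfolding g_eq by (rule subgroup.m_closed[OF subgroup_bicentralizer[OF h_carrier]])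
  qed
qed

end

section \<open>Equally large centralizer classes\<close>

locale equal_centralizer_classes = finite_group G for G (structure) +
  fixes c :: nat
  assumes card_class: "x \<in> carrier G - group_center G \<Longrightarrow> card (centralizer_class x) = c"
begin

abbreviation N :: nat where "N \<equiv> card Z + c"

lemma maximal_centralizer_iff_card:
  assumes x: "x \<in> carrier G - Z"
  shows "maximal_centralizer x \<longleftrightarrow> card (bicentralizer x) = N"
proof -
  have "card (bicentralizer x) = card Z + card (bicentralizer x - Z)"
    using card_mono[OF finite_bicentralizer group_center_subset_bicentralizer, of x]
    by (simp add: card_Diff_subset[OF finite_group_center group_center_subset_bicentralizer])
  moreover have "card (bicentralizer x - Z) = c \<longleftrightarrow> centralizer_class x = bicentralizer x - Z"
    using card_subset_eq[OF _ centralizer_class_subset[OF x]] card_class[OF x] finite_bicentralizer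
    by (metis finite_Diff)
  ultimately show ?thesis using maximal_centralizer_iff_class[OF x] by auto
qed

lemma card_bicentralizer_if_maximal:
  "maximal_centralizer x \<Longrightarrow> card (bicentralizer x) = N"
  using maximal_centralizer_iff_card maximal_centralizer_noncentral by blast

lemma dvd_card_bicentralizer:
  assumes x: "x \<in> carrier G - Z"
  shows "N dvd card (bicentralizer x)"
proof -
  obtain y where y: "maximal_centralizer y" "y \<in> bicentralizer x"
    using ex_maximal_centralizer[OF finite_carrier x] .
  then have "card (bicentralizer y) dvd card (bicentralizer x)"
    using x maximal_centralizer_noncentral bicentralizer_mono
    by (intro card_subgroup_dvd_card_subgroup subgroup_bicentralizer) auto
  then show ?thesis using card_bicentralizer_if_maximal[OF y(1)] by simp
qed

lemma card_eq_class_card_mult: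
  assumes "S \<subseteq> carrier G - Z" and "\<And>x. x \<in> S \<Longrightarrow> centralizer_class x \<subseteq> S"
  shows "card S = c * card (C ` S)"
proof (rule card_eq_fibre_mult_image)
  show "finite S" using assms(1) by (intro finite_subset_carrier) auto
  fix x assume x: "x \<in> S"
  then have "{y \<in> S. C y = C x} = centralizer_class x"
    using assms by (auto simp: centralizer_class_def)
  then show "card {y \<in> S. C y = C x} = c" using card_class x assms(1) by auto
qed

lemma card_noncentral: "order G - card Z = c * card (C ` (carrier G - Z))"
proof -
  have "card (carrier G - Z) = c * card (C ` (carrier G - Z))"
    using mem_group_center_iff by (intro card_eq_class_card_mult) (auto simp: centralizer_class_def)
  then show ?thesis
    using finite_group_center subgroup.subset[OF subgroup_group_center]
    by (simp add: card_Diff_subset order_def)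
qed

lemma class_card_dvd_card_bicentralizer_diff:
  "c dvd card (bicentralizer x) - card Z"
proof -
  have "card (bicentralizer x - Z) = c * card (C ` (bicentralizer x - Z))"
    using bicentralizer_subset_carrier mem_group_center_iff
    by (intro card_eq_class_card_mult) (auto simp: centralizer_class_def bicentralizer_def)
  then show ?thesis
    using card_Diff_subset[OF finite_group_center group_center_subset_bicentralizer]
    by (metis dvd_triv_left)
qed

lemma card_bicentralizer_pos: "x \<in> carrier G \<Longrightarrow> 0 < card (bicentralizer x)"
  using finite_bicentralizer self_mem_bicentralizer by (auto simp: card_gt_0_iff)

lemma maximal_centralizer_if_card_le:
  assumes x: "x \<in> carrier G - Z" and "card (bicentralizer x) \<le> 2 * c"
  shows "maximal_centralizer x"
proof -
  have "2 * c < 2 * N" using card_group_center_pos by simp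
  then have "\<not> 2 * N \<le> card (bicentralizer x)" using assms(2) by linarith
  then have "N = card (bicentralizer x)"
    using double_le_if_dvd_neq dvd_card_bicentralizer[OF x] card_bicentralizer_pos x by blast
  then show ?thesis using maximal_centralizer_iff_card[OF x] by simp
qed

lemma card_bicentralizer_ge_if_not_maximal:
  assumes x: "x \<in> carrier G - Z" and "\<not> maximal_centralizer x" and "k * card Z \<le> N"
  shows "k * N \<le> card (bicentralizer x)"
proof -
  obtain d where card_eq: "card (bicentralizer x) = d * N"
    using dvd_card_bicentralizer[OF x] by (metis dvdE mult.commute)
  have "d \<noteq> 0"
    using card_eq x card_bicentralizer_pos[of x] by (intro notI) simp
  moreover have "d \<noteq> 1" using card_eq assms maximal_centralizer_iff_card by auto
  ultimately have "N \<le> d * card Z"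
    using class_card_dvd_card_bicentralizer_diff[of x] card_eq card_group_center_pos
    by (intro add_le_mult_if_dvd_diff) auto
  then have "k * card Z \<le> d * card Z" using assms(3) by linarith
  then show ?thesis using card_eq card_group_center_pos by simp
qed

lemma ex_card_bicentralizer_eq:
  assumes "x \<in> carrier G - Z"
  obtains y where "y \<in> carrier G - Z" and "card (bicentralizer y) = N"
  using ex_maximal_centralizer[OF finite_carrier assms] maximal_centralizer_noncentral
    card_bicentralizer_if_maximal by metis

lemma card_center_dvd:
  assumes "x \<in> carrier G - Z"
  shows "card Z dvd c"
proof -
  obtain y where y: "y \<in> carrier G - Z" and "card (bicentralizer y) = N"
    using ex_card_bicentralizer_eq[OF assms] .
  moreover have "card Z dvd card (bicentralizer y)"
    using y subgroup_group_center group_center_subset_bicentralizer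
    by (intro card_subgroup_dvd_card_subgroup subgroup_bicentralizer) auto
  ultimately show ?thesis by simp
qed

lemma coprime_index_card_centralizers:
  assumes "x \<in> carrier G - Z" and "order G = m * N"
  shows "coprime m (card (C ` (carrier G - Z)))"
proof (rule coprime_if_mult_diff_eq)
  show "m * N - card Z = c * card (C ` (carrier G - Z))"
    using card_noncentral assms(2) by simp
  show "card Z dvd c" using assms(1) by (rule card_center_dvd)
qed (use assms(2) order_pos card_group_center_pos in auto)

lemma N_le_index_mult_card_center:
  assumes x: "x \<in> carrier G - Z" and order: "order G = m * N"
  shows "N \<le> m * card Z"
proof -
  have "m \<noteq> 0" using order order_pos by auto
  moreover have "m \<noteq> 1"
  proof
    assume "m = 1"
    obtain y where y: "y \<in> carrier G - Z" "card (bicentralizer y) = N"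
      using ex_card_bicentralizer_eq[OF x] .
    then have "bicentralizer y = carrier G"
      using order \<open>m = 1\<close> finite_carrier bicentralizer_subset_carrier
      by (intro card_subset_eq) (auto simp: order_def)
    then have "centralizer G y = carrier G"
      using y bicentralizer_subset_centralizer[of y] centralizer_subset_carrier by blast
    then show False using y mem_group_center_iff by blast
  qed
  ultimately show ?thesis
    using card_noncentral order card_group_center_pos
    by (intro add_le_mult_if_dvd_diff) auto
qed

end

locale equal_classes_coprime_order =
  equal_centralizer_classes G c + coprime_order_group G a b for G (structure) and c a b
begin

lemma equal_classes_coprime_order_swap: "equal_classes_coprime_order G c b a"
  using equal_centralizer_classes_axioms coprime_order_group_swap
  by (rule equal_classes_coprime_order.intro)

text \<open>
  If \<open>u\<close> is a noncentral \<open>a\<close>-torsion element of the bicentralizer of \<open>x\<close>, then \<open>u \<otimes> v\<close> lies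
  in the class of \<open>x\<close> for every \<open>b\<close>-torsion element \<open>v\<close>, so this class fills at least half of
  the bicentralizer, whose order is a multiple of \<open>N\<close>.
\<close>

lemma maximal_centralizer_if_maximal_on_torsion:
  assumes x: "x \<in> torsion (carrier G) a - Z"
    and max: "\<And>y. y \<in> torsion (carrier G) a - Z \<Longrightarrow> C x \<subseteq> C y \<Longrightarrow> C y = C x"
  shows "maximal_centralizer x"
proof -
  let ?A = "bicentralizer x"
  let ?P = "torsion ?A a - Z" and ?Q = "torsion ?A b"
  have noncentral: "x \<in> carrier G - Z" using x by (simp add: torsion_def)
  then have commutative: "commutative_subgroup ?A" by (intro commutative_subgroup_bicentralizer) simp
  interpret swap: coprime_order_group G b a by (rule coprime_order_group_swap)
  have "card (?P \<times> ?Q) \<le> card (centralizer_class x)"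
  proof (rule card_torsion_pairs_le[OF commutative coprime_ab])
    fix u v assume uv: "(u, v) \<in> ?P \<times> ?Q"
    then have "C u = C x" by (intro max) (auto simp: torsion_def bicentralizer_def)
    then show "u \<otimes> v \<in> centralizer_class x"
      using uv noncentral by (intro mult_mem_centralizer_class[OF _ coprime_ab]) auto
  qed (auto simp: centralizer_class_def finite_carrier)
  then have "(gcd (card ?A) a - gcd (card Z) a) * gcd (card ?A) b \<le> c"
    using card_class[OF noncentral]
      card_torsion_minus_center[OF commutative group_center_subset_bicentralizer]
    by (simp add: card_cartesian_product swap.card_torsion[OF commutative])
  moreover have "2 * gcd (card Z) a \<le> gcd (card ?A) a"
    using x noncentral self_mem_bicentralizer group_center_subset_bicentralizer
    by (intro double_gcd_card_center_le commutative) (auto simp: torsion_def)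
  then have "gcd (card ?A) a * gcd (card ?A) b
      \<le> 2 * (gcd (card ?A) a - gcd (card Z) a) * gcd (card ?A) b"
    by (intro mult_le_mono1) linarith
  ultimately have "card ?A \<le> 2 * c"
    using card_eq_gcd_mult_gcd[OF commutative] by linarith
  with noncentral show ?thesis by (rule maximal_centralizer_if_card_le)
qed

lemma double_gcd_card_center_le_gcd_N:
  assumes "\<not> torsion (carrier G) a \<subseteq> Z"
  shows "2 * gcd (card Z) a \<le> gcd N a"
proof -
  let ?S = "torsion (carrier G) a - Z"
  obtain u where u: "u \<in> ?S" using assms by blast
  have "finite ?S" by (intro finite_subset_carrier) (auto simp: torsion_def)
  then obtain x where x: "x \<in> ?S" and "\<And>w. w \<in> ?S \<Longrightarrow> C x \<subseteq> C w \<Longrightarrow> C w = C x"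
    using ex_centralizer_maximal_on[OF _ u] by metis
  then have "maximal_centralizer x" by (rule maximal_centralizer_if_maximal_on_torsion)
  moreover have "2 * gcd (card Z) a \<le> gcd (card (bicentralizer x)) a"
    using x self_mem_bicentralizer group_center_subset_bicentralizer
    by (intro double_gcd_card_center_le commutative_subgroup_bicentralizer) (auto simp: torsion_def)
  ultimately show ?thesis by (simp add: card_bicentralizer_if_maximal)
qed

lemma bicentralizer_torsion_noncentral:
  assumes "\<not> torsion (carrier G) a \<subseteq> Z" and x: "x \<in> carrier G - Z"
  shows "\<not> torsion (bicentralizer x) a \<subseteq> Z"
proof -
  obtain y where y: "maximal_centralizer y" "y \<in> bicentralizer x"
    using ex_maximal_centralizer[OF finite_carrier x] .
  then have y_carrier: "y \<in> carrier G" using maximal_centralizer_noncentral by blast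
  have "0 < gcd (card Z) a" using card_group_center_pos by simp
  then have "gcd (card Z) a < gcd N a"
    using double_gcd_card_center_le_gcd_N[OF assms(1)] by linarith
  then have "card (torsion (bicentralizer y) a - Z) \<noteq> 0"
    using card_torsion_minus_center[OF commutative_subgroup_bicentralizer[OF y_carrier]
        group_center_subset_bicentralizer] card_bicentralizer_if_maximal[OF y(1)] by simp
  then have "torsion (bicentralizer y) a - Z \<noteq> {}" by (metis card.empty)
  then show ?thesis using torsion_mono[OF bicentralizer_mono[OF y(2)]] by blast
qed

text \<open>
  If \<open>u \<otimes> v\<close> does not lie in the class of \<open>x\<close>, then its centralizer \<open>C u \<inter> C v\<close> is maximal, and
  therefore equal to \<open>C u\<close>.
\<close>

lemma maximal_bicentralizer_of_torsion_parts:
  assumes x: "submaximal_centralizer x"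
    and u: "u \<in> torsion (bicentralizer x) a - Z" and v: "v \<in> torsion (bicentralizer x) b"
    and neq: "C (u \<otimes> v) \<noteq> C x"
  shows "maximal_centralizer u" and "v \<in> torsion (bicentralizer u) b"
proof -
  let ?A = "bicentralizer x"
  have commutative: "commutative_subgroup ?A"
    using submaximal_centralizer_noncentral[OF x] by (intro commutative_subgroup_bicentralizer) simp
  have carriers: "u \<in> carrier G" "v \<in> carrier G"
    using u v by (auto simp: torsion_def bicentralizer_def)
  have C_mult: "C (u \<otimes> v) = C u \<inter> C v"
    using u v by (intro centralizer_mult_torsion[OF commutative coprime_ab]) auto
  then have "u \<otimes> v \<notin> Z"
    using u carriers mem_group_center_iff centralizer_subset_carrier by blast
  moreover have "u \<otimes> v \<in> ?A"
    using commutative u v by (simp add: commutative_subgroup_def subgroup.m_closed torsion_def)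
  ultimately have maximal_mult: "maximal_centralizer (u \<otimes> v)"
    using x neq unfolding submaximal_centralizer_def by blast
  then have "C u = C (u \<otimes> v)"
    using u carriers C_mult unfolding maximal_centralizer_def by blast
  then show "maximal_centralizer u" "v \<in> torsion (bicentralizer u) b"
    using maximal_mult u v carriers C_mult
    by (auto simp: maximal_centralizer_def bicentralizer_def torsion_def)
qed

lemma gcd_diff_le_card_torsion_partners:
  assumes x: "submaximal_centralizer x" and u: "u \<in> torsion (bicentralizer x) a - Z"
  shows "gcd (card (bicentralizer x)) b - gcd N b
    \<le> card {v \<in> torsion (bicentralizer x) b. C (u \<otimes> v) = C x}"
proof -
  let ?Q = "torsion (bicentralizer x) b"
  let ?R = "{v \<in> ?Q. C (u \<otimes> v) \<noteq> C x}"
  interpret swap: coprime_order_group G b a by (rule coprime_order_group_swap)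
  have finite_torsion: "finite (torsion (bicentralizer y) b)" for y
    using torsion_subset finite_bicentralizer by (rule finite_subset)
  have "card ?R \<le> gcd N b"
  proof (cases "?R = {}")
    case True
    then show ?thesis by (simp only: card.empty)
  next
    case False
    then have maximal_u: "maximal_centralizer u"
      using maximal_bicentralizer_of_torsion_parts(1)[OF x u] by blast
    have "card ?R \<le> card (torsion (bicentralizer u) b)"
      using maximal_bicentralizer_of_torsion_parts(2)[OF x u]
      by (intro card_mono finite_torsion) auto
    also have "\<dots> = gcd N b"
      using maximal_u maximal_centralizer_noncentral[OF maximal_u]
      by (simp add: swap.card_torsion commutative_subgroup_bicentralizer
          card_bicentralizer_if_maximal)
    finally show ?thesis .
  qed
  moreover have "card ?Q = gcd (card (bicentralizer x)) b"
    using submaximal_centralizer_noncentral[OF x]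
    by (simp add: swap.card_torsion commutative_subgroup_bicentralizer)
  moreover have "{v \<in> ?Q. C (u \<otimes> v) = C x} = ?Q - ?R" by blast
  then have "card {v \<in> ?Q. C (u \<otimes> v) = C x} = card ?Q - card ?R"
    using finite_torsion by (simp add: card_Diff_subset)
  ultimately show ?thesis by simp
qed

lemma torsion_mult_le_class_card:
  assumes x: "submaximal_centralizer x"
  shows "(gcd (card (bicentralizer x)) a - gcd (card Z) a)
    * (gcd (card (bicentralizer x)) b - gcd N b) \<le> c"
proof -
  let ?A = "bicentralizer x"
  let ?P = "torsion ?A a - Z"
  let ?R = "\<lambda>u. {v \<in> torsion ?A b. C (u \<otimes> v) = C x}"
  have noncentral: "x \<in> carrier G - Z" using x by (rule submaximal_centralizer_noncentral)
  then have commutative: "commutative_subgroup ?A" by (intro commutative_subgroup_bicentralizer) simp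
  have finite_torsion: "finite (torsion ?A k)" for k
    using torsion_subset finite_bicentralizer by (rule finite_subset)
  have "card ?P * (gcd (card ?A) b - gcd N b) = (\<Sum>u\<in>?P. gcd (card ?A) b - gcd N b)"
    by simp
  also have "\<dots> \<le> (\<Sum>u\<in>?P. card (?R u))"
    using gcd_diff_le_card_torsion_partners[OF x] by (intro sum_mono)
  also have "\<dots> = card (Sigma ?P ?R)"
    using finite_torsion by (intro card_SigmaI[symmetric]) auto
  also have "\<dots> \<le> card (centralizer_class x)"
  proof (rule card_torsion_pairs_le[OF commutative coprime_ab])
    show "u \<otimes> v \<in> centralizer_class x" if "(u, v) \<in> Sigma ?P ?R" for u v
      using that by (auto simp: centralizer_class_def torsion_def bicentralizer_def)
  qed (auto simp: centralizer_class_def finite_carrier)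
  also have "\<dots> = c" using noncentral by (rule card_class)
  finally show ?thesis
    using card_torsion_minus_center[OF commutative group_center_subset_bicentralizer] by simp
qed

lemma card_bicentralizer_le_if_submaximal:
  assumes x: "submaximal_centralizer x"
    and noncentral: "\<not> torsion (carrier G) a \<subseteq> Z"
    and neq: "gcd N b \<noteq> gcd (card (bicentralizer x)) b"
  shows "card (bicentralizer x) \<le> 4 * c"
proof -
  let ?\<alpha> = "gcd (card (bicentralizer x)) a" and ?\<beta> = "gcd (card (bicentralizer x)) b"
  have x_noncentral: "x \<in> carrier G - Z" using x by (rule submaximal_centralizer_noncentral)
  then have commutative: "commutative_subgroup (bicentralizer x)"
    by (intro commutative_subgroup_bicentralizer) simp
  have "gcd N b dvd ?\<beta>"
    using dvd_card_bicentralizer[OF x_noncentral] dvd_refl by (rule gcd_mono)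
  then have "2 * gcd N b \<le> ?\<beta>"
    using neq card_bicentralizer_pos x_noncentral by (intro double_le_if_dvd_neq) auto
  moreover have "2 * gcd (card Z) a \<le> ?\<alpha>"
    using bicentralizer_torsion_noncentral[OF noncentral x_noncentral]
      group_center_subset_bicentralizer
    by (intro double_gcd_card_center_le commutative)
  ultimately have "?\<alpha> * ?\<beta> \<le> (2 * (?\<alpha> - gcd (card Z) a)) * (2 * (?\<beta> - gcd N b))"
    by (intro mult_le_mono) linarith+
  then show ?thesis
    using torsion_mult_le_class_card[OF x] card_eq_gcd_mult_gcd[OF commutative] by linarith
qed

lemma N_eq_gcd_mult_gcd:
  assumes "x \<in> carrier G - Z"
  shows "N = gcd N a * gcd N b"
  using ex_card_bicentralizer_eq[OF assms] commutative_subgroup_bicentralizer card_eq_gcd_mult_gcd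
  by (metis DiffD1)

lemma torsion_central_if_not_maximal:
  assumes h: "h \<in> carrier G - Z" "\<not> maximal_centralizer h"
  shows "torsion (carrier G) a \<subseteq> Z \<or> torsion (carrier G) b \<subseteq> Z"
proof (rule ccontr)
  interpret swap: equal_classes_coprime_order G c b a by (rule equal_classes_coprime_order_swap)
  assume "\<not> ?thesis"
  then have noncentral_a: "\<not> torsion (carrier G) a \<subseteq> Z"
    and noncentral_b: "\<not> torsion (carrier G) b \<subseteq> Z" by auto
  obtain x where x: "submaximal_centralizer x"
    using ex_submaximal_centralizer[OF finite_carrier h] .
  have x_noncentral: "x \<in> carrier G - Z" and not_max: "\<not> maximal_centralizer x"
    using x by (simp_all add: submaximal_centralizer_def)
  let ?A = "bicentralizer x"
  have commutative: "commutative_subgroup ?A"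
    using x_noncentral by (intro commutative_subgroup_bicentralizer) simp
  have "2 * gcd (card Z) a * (2 * gcd (card Z) b) \<le> gcd N a * gcd N b"
    using double_gcd_card_center_le_gcd_N[OF noncentral_a]
      swap.double_gcd_card_center_le_gcd_N[OF noncentral_b]
    by (rule mult_le_mono)
  then have "4 * card Z \<le> N"
    using N_eq_gcd_mult_gcd[OF h(1)] card_eq_gcd_mult_gcd[OF commutative_subgroup_group_center]
    by linarith
  then have "4 * N \<le> card ?A"
    using x_noncentral not_max by (intro card_bicentralizer_ge_if_not_maximal)
  moreover have "4 * c < 4 * N" using card_group_center_pos by simp
  ultimately have "\<not> card ?A \<le> 4 * c" by linarith
  then have "gcd N a = gcd (card ?A) a" "gcd N b = gcd (card ?A) b"
    using swap.card_bicentralizer_le_if_submaximal[OF x noncentral_b]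
      card_bicentralizer_le_if_submaximal[OF x noncentral_a] by blast+
  then have "card ?A = N"
    using N_eq_gcd_mult_gcd[OF h(1)] card_eq_gcd_mult_gcd[OF commutative] by simp
  then show False using not_max maximal_centralizer_iff_card[OF x_noncentral] by blast
qed

lemma card_noncentral_torsion:
  assumes maximal: "\<And>h. h \<in> carrier G - Z \<Longrightarrow> maximal_centralizer h"
    and noncentral: "\<not> torsion (carrier G) a \<subseteq> Z"
  shows "card (torsion (carrier G) a - Z)
    = (gcd N a - gcd (card Z) a) * card (C ` (carrier G - Z))"
proof -
  let ?E = "torsion (carrier G) a - Z"
  have E_subset: "?E \<subseteq> carrier G - Z" by (auto simp: torsion_def)
  have "card ?E = (gcd N a - gcd (card Z) a) * card (C ` ?E)"
  proof (rule card_eq_fibre_mult_image)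
    show "finite ?E" using E_subset by (intro finite_subset_carrier) auto
    fix x assume "x \<in> ?E"
    then have x: "x \<in> carrier G - Z" using E_subset by blast
    have "{y \<in> ?E. C y = C x} = torsion (bicentralizer x) a - Z"
      using centralizer_eq_if_maximal[OF maximal[OF x]]
      by (auto simp: torsion_def bicentralizer_def)
    then show "card {y \<in> ?E. C y = C x} = gcd N a - gcd (card Z) a"
      using card_torsion_minus_center[of "bicentralizer x"] commutative_subgroup_bicentralizer x
        group_center_subset_bicentralizer card_bicentralizer_if_maximal[OF maximal[OF x]]
      by simp
  qed
  moreover have "C x \<in> C ` ?E" if x: "x \<in> carrier G - Z" for x
  proof -
    obtain u where "u \<in> torsion (bicentralizer x) a - Z"
      using bicentralizer_torsion_noncentral[OF noncentral x] by blast
    then have "C u = C x" "u \<in> ?E"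
      using centralizer_eq_if_maximal[OF maximal[OF x], of u]
      by (auto simp: torsion_def bicentralizer_def)
    then show ?thesis by blast
  qed
  then have "C ` ?E = C ` (carrier G - Z)" using E_subset by blast
  ultimately show ?thesis by simp
qed

lemma index_dvd_gcd_diff:
  assumes commutative: "\<And>h. h \<in> carrier G - Z \<Longrightarrow> C h = bicentralizer h"
    and noncentral: "\<not> torsion (carrier G) a \<subseteq> Z" and order: "order G = m * N"
  shows "m dvd gcd N a - gcd (card Z) a"
proof -
  let ?E = "torsion (carrier G) a - Z"
  have maximal: "maximal_centralizer h" if "h \<in> carrier G - Z" for h
    using commutative that by (rule maximal_centralizer_if_eq_bicentralizer)
  have E_subset: "?E \<subseteq> carrier G - Z" by (auto simp: torsion_def)
  obtain h where h: "h \<in> carrier G - Z" using noncentral E_subset by blast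
  have "m dvd card ?E"
  proof (rule card_conj_closed[OF finite_carrier _ _ _ order])
    show "g \<otimes> x \<otimes> inv g \<in> ?E" if "g \<in> carrier G" "x \<in> ?E" for g x
      using conj_mem_torsion[OF that(1)] conj_notin_normal[OF normal_group_center that(1)] that(2)
      by (auto simp: torsion_def)
    show "card (C x) = N" if "x \<in> ?E" for x
      using that E_subset commutative card_bicentralizer_if_maximal[OF maximal] by auto
  qed (use E_subset in blast)
  then have "m dvd (gcd N a - gcd (card Z) a) * card (C ` (carrier G - Z))"
    using card_noncentral_torsion[OF maximal noncentral] by simp
  then show ?thesis
    using coprime_index_card_centralizers[OF h order] by (simp add: coprime_dvd_mult_left_iff)
qed

lemma torsion_central_if_commutative_centralizers:
  assumes commutative: "\<And>h. h \<in> carrier G - Z \<Longrightarrow> C h = bicentralizer h"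
  shows "torsion (carrier G) a \<subseteq> Z \<or> torsion (carrier G) b \<subseteq> Z"
proof (rule ccontr)
  interpret swap: equal_classes_coprime_order G c b a by (rule equal_classes_coprime_order_swap)
  assume "\<not> ?thesis"
  then have noncentral_a: "\<not> torsion (carrier G) a \<subseteq> Z"
    and noncentral_b: "\<not> torsion (carrier G) b \<subseteq> Z" by auto
  then obtain h where h: "h \<in> carrier G - Z" by (auto simp: torsion_def)
  obtain y where y: "y \<in> carrier G - Z" "card (bicentralizer y) = N"
    using ex_card_bicentralizer_eq[OF h] .
  obtain m where order: "order G = m * N"
    using lagrange[OF subgroup_bicentralizer] y by (metis DiffD1)
  have "m * (gcd (card Z) a * gcd (card Z) b) < gcd N a * gcd N b"
  proof (rule mult_less_mult_if_dvd_diff[OF coprime_ab])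
    show "m dvd a * b" using order order_eq by (metis dvd_triv_left)
    have "card Z dvd N" using card_center_dvd[OF h] by simp
    then show "gcd (card Z) a dvd gcd N a" "gcd (card Z) b dvd gcd N b"
      by (simp_all only: gcd_mono dvd_refl)
    have "0 < gcd (card Z) a" "0 < gcd (card Z) b" using card_group_center_pos by simp_all
    then show "gcd (card Z) a < gcd N a" "gcd (card Z) b < gcd N b"
      using double_gcd_card_center_le_gcd_N[OF noncentral_a]
        swap.double_gcd_card_center_le_gcd_N[OF noncentral_b] by linarith+
    show "m dvd gcd N a - gcd (card Z) a"
      using commutative noncentral_a order by (rule index_dvd_gcd_diff)
    show "m dvd gcd N b - gcd (card Z) b"
      using commutative noncentral_b order by (rule swap.index_dvd_gcd_diff)
  qed simp_all
  then have "m * card Z < N"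
    using card_eq_gcd_mult_gcd[OF commutative_subgroup_group_center] N_eq_gcd_mult_gcd[OF h] by simp
  then show False using N_le_index_mult_card_center[OF h order] by simp
qed

lemma torsion_central: "torsion (carrier G) a \<subseteq> Z \<or> torsion (carrier G) b \<subseteq> Z"
proof (rule ccontr)
  interpret swap: equal_classes_coprime_order G c b a by (rule equal_classes_coprime_order_swap)
  assume noncentral: "\<not> ?thesis"
  then have "maximal_centralizer h" if "h \<in> carrier G - Z" for h
    using that torsion_central_if_not_maximal by blast
  then have "C h = bicentralizer h" if "h \<in> carrier G - Z" for h
    using noncentral that bicentralizer_torsion_noncentral swap.bicentralizer_torsion_noncentral
    by (intro centralizer_eq_bicentralizer) auto
  then show False using noncentral torsion_central_if_commutative_centralizers by blast
qed

lemma index_center_dvd_coprime_factor: "card (rcosets Z) dvd a \<or> card (rcosets Z) dvd b"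
  using torsion_central index_dvd_if_torsion_subset[OF normal_group_center]
    coprime_order_group.index_dvd_if_torsion_subset[OF coprime_order_group_swap normal_group_center]
  by blast

end

section \<open>Induced regular groups\<close>

lemma (in finite_group) card_centralizer_class_eq_diff_degree:
  assumes x: "x \<in> carrier G - Z"
  shows "card (centralizer_class x) = card (carrier G - Z) - induced_nc_degree G x"
proof -
  have "centralizer_class x \<subseteq> carrier G - Z"
    using centralizer_class_subset[OF x] bicentralizer_subset_carrier by blast
  then have "centralizer_class x = (carrier G - Z) - {y \<in> carrier G - Z. noncentralizer_adj G x y}"
    by (auto simp: centralizer_class_def noncentralizer_adj_def)
  then show ?thesis
    unfolding induced_nc_degree_def using finite_carrier
    by (metis (no_types, lifting) card_Diff_subset finite_Diff finite_subset mem_Collect_eq subsetI)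
qed

lemma (in finite_group) ex_equal_centralizer_classes:
  assumes "induced_regular G"
  shows "\<exists>c. equal_centralizer_classes G c"
proof -
  obtain k where "\<And>x. x \<in> carrier G - Z \<Longrightarrow> induced_nc_degree G x = k"
    using assms unfolding induced_regular_def by metis
  then have "equal_centralizer_classes G (card (carrier G - Z) - k)"
    using card_centralizer_class_eq_diff_degree by unfold_locales auto
  then show ?thesis by blast
qed

theorem theorem3p5:
  fixes G (structure)
  assumes "group G"
    and "finite (carrier G)"
    and "\<not> comm_group G"
    and "induced_regular G"
  shows "\<exists>p. is_p_group (G Mod group_center G) p"
proof -
  interpret finite_group G
    using assms(1,2) by (simp add: finite_group_def finite_group_axioms_def)
  obtain c where "equal_centralizer_classes G c"
    using ex_equal_centralizer_classes[OF assms(4)] by blast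
  then have "card (rcosets Z) dvd a \<or> card (rcosets Z) dvd b"
    if "order G = a * b" "coprime a b" for a b
    using that finite_group_axioms
    by (intro equal_classes_coprime_order.index_center_dvd_coprime_factor
        equal_classes_coprime_order.intro coprime_order_group.intro coprime_order_group_axioms.intro)
  then obtain p j where "Factorial_Ring.prime p" "card (rcosets Z) = p ^ j"
    using prime_power_if_dvd_coprime_factor[OF order_pos] by blast
  moreover have "finite (carrier (G Mod Z))"
    using finite_carrier by (simp add: carrier_FactGroup)
  ultimately show ?thesis
    unfolding is_p_group_def by (auto simp: order_def FactGroup_def)
qed

end
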